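(* Let $V:\mathbb R\to\mathbb C$ satisfy $V\in L^2_{\rm loc}(\mathbb R)$ and $|V(x)|\to\infty$ as $|x|\to\infty$. For some $\theta\in[0,\pi/2)$ let $\mathcal S_\theta=\{\lambda\in\mathbb C:|\arg(\lambda)|\le\theta\}$. Assume that there exist $-\infty<a<b<\infty$, $\varphi_\pm\in(-\pi/2,\pi/2)$ and $r>0$ such that, for almost all $x\in\mathbb R$, $$V(x)\in\begin{cases} e^{i\varphi_-}\mathcal S_\theta,& x\in(-\infty,a],\\ B_r(0),& x\in(a,b),\\ e^{i\varphi_+}\mathcal S_\theta,& x\in[b,\infty).\end{cases}$$ Let $T$ be the closure in $L^2(\mathbb R)$ of the operator $T_0f=-f''+Vf$, $\operatorname{dom}(T_0)=C_0^\infty(\mathbb R)$. Let $B$ be the operator of multiplication by the bounded continuous function $$B(x)=\begin{cases} e^{-i\varphi_-},& x\in(-\infty,a],\\ e^{-i(t\varphi_-+(1-t)\varphi_+)},& x\in(a,b),\ t=\frac{b-x}{b-a},\\ e^{-i\varphi_+},& x\in[b,\infty).\end{cases}$$ Then $W_e(BT)=\emptyset$, and thus $w_e(BT,B)=W_e(BT,B)=\emptyset$.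
   Context: $B_r(0)=\{z\in\mathbb C:|z|<r\}$. For a linear operator $S$ in a Hilbert space, $W_e(S)$ is the set of all $\mu\in\mathbb C$ for which there are $x_n\in\operatorname{dom}(S)$ with $\|x_n\|=1$, $x_n\to0$ weakly and $\langle Sx_n,x_n\rangle\to\mu$. For linear operators $A,B$ with $\operatorname{dom}(A)\subseteq\operatorname{dom}(B)$ (and $A-\lambda B$ defined on $\operatorname{dom}(A)$): $W_e(A,B)=\{\lambda\in\mathbb C:0\in W_e(A-\lambda B)\}$, and $w_e(A,B)$ is the set of all limits $\lim_{n\to\infty}\frac{\langle Ax_n,x_n\rangle}{\langle Bx_n,x_n\rangle}$ with $x_n\in\operatorname{dom}(A)$, $\langle Bx_n,x_n\rangle\neq0$, $\|x_n\|=1$, $x_n\to0$ weakly. *)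

theory Defs
  imports "HOL-Analysis.Analysis"
begin

section \<open>Complex inner product spaces\<close>

text \<open>
  The real inner product is the real part of the complex one, so that norm and topology are those
  of the library class \<^class>\<open>real_inner\<close>. The complex inner product is linear in its
  first argument.
\<close>

class complex_inner = real_inner +
  fixes scaleC :: "complex \<Rightarrow> 'a \<Rightarrow> 'a"  (infixr "*\<^sub>C" 75)
    and cinner :: "'a \<Rightarrow> 'a \<Rightarrow> complex"
  assumes scaleC_of_real: "complex_of_real r *\<^sub>C x = r *\<^sub>R x"
    and scaleC_add_left: "(c + d) *\<^sub>C x = c *\<^sub>C x + d *\<^sub>C x"
    and scaleC_add_right: "c *\<^sub>C (x + y) = c *\<^sub>C x + c *\<^sub>C y"
    and scaleC_scaleC: "c *\<^sub>C d *\<^sub>C x = (c * d) *\<^sub>C x"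
    and cinner_commute: "cinner x y = cnj (cinner y x)"
    and cinner_add_left: "cinner (x + y) z = cinner x z + cinner y z"
    and cinner_scaleC_left: "cinner (c *\<^sub>C x) y = c * cinner x y"
    and inner_eq_Re_cinner: "inner x y = Re (cinner x y)"


section \<open>The Hilbert space \<open>L\<^sup>2(\<real>)\<close>\<close>

definition square_integrable :: "(real \<Rightarrow> complex) \<Rightarrow> bool" where
  "square_integrable f \<longleftrightarrow>
     f \<in> borel_measurable lebesgue \<and> integrable lebesgue (\<lambda>x. (norm (f x))\<^sup>2)"

definition L2_eq :: "(real \<Rightarrow> complex) \<Rightarrow> (real \<Rightarrow> complex) \<Rightarrow> bool" where
  "L2_eq f g \<longleftrightarrow> square_integrable f \<and> square_integrable g \<and> (AE x in lebesgue. f x = g x)"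

lemma square_integrable_zero: "square_integrable (\<lambda>x. 0)"
  by (simp add: square_integrable_def)

lemma square_integrable_add:
  assumes "square_integrable f" "square_integrable g"
  shows "square_integrable (\<lambda>x. f x + g x)"
proof -
  have [measurable]: "f \<in> borel_measurable lebesgue" "g \<in> borel_measurable lebesgue"
    and i: "integrable lebesgue (\<lambda>x. 2 * (norm (f x))\<^sup>2 + 2 * (norm (g x))\<^sup>2)"
    using assms by (auto simp: square_integrable_def)
  have "(norm (f x + g x))\<^sup>2 \<le> 2 * (norm (f x))\<^sup>2 + 2 * (norm (g x))\<^sup>2" for x
  proof -
    have "(norm (f x + g x))\<^sup>2 \<le> (norm (f x) + norm (g x))\<^sup>2"
      by (intro power_mono norm_triangle_ineq norm_ge_zero)
    also have "\<dots> \<le> 2 * (norm (f x))\<^sup>2 + 2 * (norm (g x))\<^sup>2"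
      using sum_squares_bound[of "norm (f x)" "norm (g x)"] by (simp add: power2_sum)
    finally show ?thesis .
  qed
  then have "integrable lebesgue (\<lambda>x. (norm (f x + g x))\<^sup>2)"
    by (intro Bochner_Integration.integrable_bound[OF i]) auto
  then show ?thesis
    by (simp add: square_integrable_def)
qed

lemma square_integrable_scale:
  assumes "square_integrable f"
  shows "square_integrable (\<lambda>x. c * f x)"
  using assms by (auto simp: square_integrable_def norm_mult power_mult_distrib)

lemma square_integrable_uminus:
  assumes "square_integrable f"
  shows "square_integrable (\<lambda>x. - f x)"
  using square_integrable_scale[OF assms, of "-1"] by simp

lemma square_integrable_diff:
  assumes "square_integrable f" "square_integrable g"
  shows "square_integrable (\<lambda>x. f x - g x)"
  using square_integrable_add[OF assms(1) square_integrable_uminus[OF assms(2)]] by simp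

lemma borel_measurable_cnj [measurable (raw)]:
  "f \<in> borel_measurable M \<Longrightarrow> (\<lambda>x. cnj (f x)) \<in> borel_measurable M"
  by (rule measurable_compose[OF _ borel_measurable_continuous_onI]) (auto intro: continuous_intros)

lemma integrable_mult_cnj:
  assumes "square_integrable f" "square_integrable g"
  shows "integrable lebesgue (\<lambda>x. f x * cnj (g x))"
proof -
  have [measurable]: "f \<in> borel_measurable lebesgue" "g \<in> borel_measurable lebesgue"
    and i: "integrable lebesgue (\<lambda>x. (norm (f x))\<^sup>2 + (norm (g x))\<^sup>2)"
    using assms by (auto simp: square_integrable_def)
  have "norm (f x * cnj (g x)) \<le> (norm (f x))\<^sup>2 + (norm (g x))\<^sup>2" for x
    using sum_squares_bound[of "norm (f x)" "norm (g x)"]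
          mult_nonneg_nonneg[OF norm_ge_zero norm_ge_zero, of "f x" "g x"]
    unfolding norm_mult complex_mod_cnj mult.assoc by linarith
  moreover have "(\<lambda>x. f x * cnj (g x)) \<in> borel_measurable lebesgue"
    by measurable
  ultimately show ?thesis
    by (intro Bochner_Integration.integrable_bound[OF i]) auto
qed

lemma integral_mult_cnj_self:
  "integral\<^sup>L lebesgue (\<lambda>x. f x * cnj (f x)) =
     complex_of_real (integral\<^sup>L lebesgue (\<lambda>x. (norm (f x))\<^sup>2))"
  unfolding complex_norm_square[symmetric] by (rule integral_complex_of_real)

quotient_type L2R = "real \<Rightarrow> complex" / partial: L2_eq
proof (rule part_equivpI)
  show "\<exists>f. L2_eq f f"
    using square_integrable_zero by (auto simp: L2_eq_def)
  show "symp L2_eq"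
    by (auto simp: symp_def L2_eq_def)
  show "transp L2_eq"
    unfolding transp_def L2_eq_def by (auto elim: AE_mp)
qed

instantiation L2R :: real_vector
begin

lift_definition zero_L2R :: L2R is "\<lambda>x. 0"
  by (simp add: L2_eq_def square_integrable_zero)

lift_definition plus_L2R :: "L2R \<Rightarrow> L2R \<Rightarrow> L2R" is "\<lambda>f g x. f x + g x"
  by (auto simp: L2_eq_def square_integrable_add)

lift_definition minus_L2R :: "L2R \<Rightarrow> L2R \<Rightarrow> L2R" is "\<lambda>f g x. f x - g x"
  by (auto simp: L2_eq_def square_integrable_diff)

lift_definition uminus_L2R :: "L2R \<Rightarrow> L2R" is "\<lambda>f x. - f x"
  by (auto simp: L2_eq_def square_integrable_uminus)

lift_definition scaleR_L2R :: "real \<Rightarrow> L2R \<Rightarrow> L2R" is "\<lambda>r f x. complex_of_real r * f x"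
  by (auto simp: L2_eq_def square_integrable_scale)

instance
proof
  fix u v w :: L2R and r s :: real
  show "u + v + w = u + (v + w)"
    by transfer (auto simp: L2_eq_def square_integrable_add add.assoc)
  show "u + v = v + u"
    by transfer (auto simp: L2_eq_def square_integrable_add add.commute)
  show "0 + u = u"
    by transfer (auto simp: L2_eq_def)
  show "- u + u = 0"
    by transfer (auto simp: L2_eq_def square_integrable_zero)
  show "u - v = u + - v"
    by transfer (auto simp: L2_eq_def square_integrable_diff)
  show "r *\<^sub>R (u + v) = r *\<^sub>R u + r *\<^sub>R v"
    by transfer (auto simp: L2_eq_def square_integrable_add square_integrable_scale ring_distribs)
  show "(r + s) *\<^sub>R u = r *\<^sub>R u + s *\<^sub>R u"
    by transfer (auto simp: L2_eq_def square_integrable_add square_integrable_scale ring_distribs)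
  show "r *\<^sub>R s *\<^sub>R u = (r * s) *\<^sub>R u"
    by transfer (auto simp: L2_eq_def square_integrable_scale mult.assoc)
  show "1 *\<^sub>R u = u"
    by transfer (auto simp: L2_eq_def)
qed

end

instantiation L2R :: complex_inner
begin

lift_definition scaleC_L2R :: "complex \<Rightarrow> L2R \<Rightarrow> L2R" is "\<lambda>c f x. c * f x"
  by (auto simp: L2_eq_def square_integrable_scale)

lift_definition cinner_L2R :: "L2R \<Rightarrow> L2R \<Rightarrow> complex"
  is "\<lambda>f g. integral\<^sup>L lebesgue (\<lambda>x. f x * cnj (g x))"
proof -
  fix f f' g g' :: "real \<Rightarrow> complex"
  assume *: "L2_eq f f'" "L2_eq g g'"
  have [measurable]: "f \<in> borel_measurable lebesgue" "g \<in> borel_measurable lebesgue"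
       "f' \<in> borel_measurable lebesgue" "g' \<in> borel_measurable lebesgue"
    using * by (auto simp: L2_eq_def square_integrable_def)
  have "AE x in lebesgue. f x * cnj (g x) = f' x * cnj (g' x)"
    using * by (auto simp: L2_eq_def)
  then show "integral\<^sup>L lebesgue (\<lambda>x. f x * cnj (g x)) = integral\<^sup>L lebesgue (\<lambda>x. f' x * cnj (g' x))"
    by (intro integral_cong_AE) measurable
qed

definition inner_L2R :: "L2R \<Rightarrow> L2R \<Rightarrow> real" where
  "inner_L2R u v = Re (cinner u v)"

definition norm_L2R :: "L2R \<Rightarrow> real" where
  "norm_L2R u = sqrt (inner u u)"

definition dist_L2R :: "L2R \<Rightarrow> L2R \<Rightarrow> real" where
  "dist_L2R u v = norm (u - v)"

definition sgn_L2R :: "L2R \<Rightarrow> L2R" where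
  "sgn_L2R u = u /\<^sub>R norm u"

definition uniformity_L2R :: "(L2R \<times> L2R) filter" where
  "uniformity_L2R = (INF e\<in>{0<..}. principal {(u, v). dist u v < e})"

definition open_L2R :: "L2R set \<Rightarrow> bool" where
  "open_L2R U \<longleftrightarrow> (\<forall>u\<in>U. eventually (\<lambda>(u', v). u' = u \<longrightarrow> v \<in> U) uniformity)"

instance
proof
  fix u v w :: L2R and c d :: complex and r s :: real
  show CR: "complex_of_real r *\<^sub>C u = r *\<^sub>R u"
    by transfer (auto simp: L2_eq_def square_integrable_scale)
  show "c *\<^sub>C (u + v) = c *\<^sub>C u + c *\<^sub>C v"
    by transfer (auto simp: L2_eq_def square_integrable_add square_integrable_scale ring_distribs)
  show "(c + d) *\<^sub>C u = c *\<^sub>C u + d *\<^sub>C u"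
    by transfer (auto simp: L2_eq_def square_integrable_add square_integrable_scale ring_distribs)
  show "c *\<^sub>C d *\<^sub>C u = (c * d) *\<^sub>C u"
    by transfer (auto simp: L2_eq_def square_integrable_scale mult.assoc)
  show "sgn u = u /\<^sub>R norm u"
    by (fact sgn_L2R_def)
  show "dist u v = norm (u - v)"
    by (fact dist_L2R_def)
  show "uniformity = (INF e\<in>{0<..}. principal {(u :: L2R, v). dist u v < e})"
    by (fact uniformity_L2R_def)
  show "open U \<longleftrightarrow> (\<forall>u\<in>U. eventually (\<lambda>(u', v). u' = u \<longrightarrow> v \<in> U) uniformity)" for U :: "L2R set"
    by (fact open_L2R_def)
  show IR: "inner u v = Re (cinner u v)" for u v :: L2R
    by (fact inner_L2R_def)
  show "norm u = sqrt (inner u u)"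
    by (fact norm_L2R_def)
  show co: "cinner u v = cnj (cinner v u)"
    by transfer (simp add: mult.commute flip: Bochner_Integration.integral_cnj)
  show ad: "cinner (u + v) w = cinner u w + cinner v w"
    by transfer (simp add: L2_eq_def distrib_right integrable_mult_cnj)
  show sc: "cinner (c *\<^sub>C u) v = c * cinner u v" for c
    by transfer (simp add: mult.assoc)
  show "inner u v = inner v u"
    using co by (simp add: IR)
  show "inner (u + v) w = inner u w + inner v w"
    using ad by (simp add: IR)
  show "inner (r *\<^sub>R u) v = r * inner u v"
    using sc[of "of_real r"] CR by (simp add: IR)
  show "0 \<le> inner u u"
    unfolding IR
    by transfer (simp add: integral_mult_cnj_self)
  show "inner u u = 0 \<longleftrightarrow> u = 0"
    unfolding IR
  proof transfer
    fix f assume "L2_eq f f"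
    then have f: "square_integrable f"
      by (simp add: L2_eq_def)
    have "Re (integral\<^sup>L lebesgue (\<lambda>x. f x * cnj (f x))) = integral\<^sup>L lebesgue (\<lambda>x. (norm (f x))\<^sup>2)"
      by (simp add: integral_mult_cnj_self)
    moreover have "integral\<^sup>L lebesgue (\<lambda>x. (norm (f x))\<^sup>2) = 0 \<longleftrightarrow> (AE x in lebesgue. (norm (f x))\<^sup>2 = 0)"
      using f by (intro integral_nonneg_eq_0_iff_AE) (auto simp: square_integrable_def)
    ultimately show "Re (integral\<^sup>L lebesgue (\<lambda>x. f x * cnj (f x))) = 0 \<longleftrightarrow> L2_eq f (\<lambda>x. 0)"
      using f by (simp add: L2_eq_def square_integrable_zero)
  qed
qed

end


section \<open>Linear operators and essential numerical ranges\<close>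

text \<open>
  A linear operator in \<open>H\<close> with arbitrary domain is represented by its graph, a subset of
  \<open>H \<times> H\<close>: \<open>dom(S)\<close> is \<^term>\<open>Domain S\<close>, and \<open>(x, y) \<in> S\<close> means
  \<open>x \<in> dom(S)\<close> and \<open>S x = y\<close>. Hence the product \<open>B A\<close>, with domain
  \<open>{x \<in> dom(A). A x \<in> dom(B)}\<close>, is \<open>A O B\<close>, and the closure of a closable operator is
  the topological \<^const>\<open>closure\<close> of its graph.
\<close>

text \<open>Weak convergence is tested against the functionals \<open>\<langle>\<cdot>, y\<rangle>\<close>, which by the Riesz
  representation theorem are all bounded functionals on a Hilbert space.\<close>

definition weakly_null :: "(nat \<Rightarrow> 'a::complex_inner) \<Rightarrow> bool" where
  "weakly_null x \<longleftrightarrow> (\<forall>y. (\<lambda>n. cinner (x n) y) \<longlonglongrightarrow> 0)"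

definition ess_num_range :: "('a::complex_inner \<times> 'a) set \<Rightarrow> complex set" where
  "ess_num_range S = {\<mu>. \<exists>x y.
     (\<forall>n. (x n, y n) \<in> S \<and> norm (x n) = 1) \<and> weakly_null x \<and>
     (\<lambda>n. cinner (y n) (x n)) \<longlonglongrightarrow> \<mu>}"

definition pencil :: "('a::complex_inner \<times> 'a) set \<Rightarrow> ('a \<times> 'a) set \<Rightarrow> complex \<Rightarrow> ('a \<times> 'a) set" where
  "pencil A B \<zeta> = {(x, y - \<zeta> *\<^sub>C z) |x y z. (x, y) \<in> A \<and> (x, z) \<in> B}"

definition pencil_ess_num_range ::
    "('a::complex_inner \<times> 'a) set \<Rightarrow> ('a \<times> 'a) set \<Rightarrow> complex set" where
  "pencil_ess_num_range A B = {\<zeta>. 0 \<in> ess_num_range (pencil A B \<zeta>)}"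

definition pencil_ess_quotients ::
    "('a::complex_inner \<times> 'a) set \<Rightarrow> ('a \<times> 'a) set \<Rightarrow> complex set" where
  "pencil_ess_quotients A B = {\<zeta>. \<exists>x y z.
     (\<forall>n. (x n, y n) \<in> A \<and> (x n, z n) \<in> B \<and> cinner (z n) (x n) \<noteq> 0 \<and> norm (x n) = 1) \<and>
     weakly_null x \<and>
     (\<lambda>n. cinner (y n) (x n) / cinner (z n) (x n)) \<longlonglongrightarrow> \<zeta>}"


section \<open>Schroedinger and multiplication operators in \<open>L\<^sup>2(\<real>)\<close>\<close>

definition locally_square_integrable :: "(real \<Rightarrow> complex) \<Rightarrow> bool" where
  "locally_square_integrable V \<longleftrightarrow> V \<in> borel_measurable lebesgue \<and>
     (\<forall>K. compact K \<longrightarrow> set_integrable lebesgue K (\<lambda>x. (norm (V x))\<^sup>2))"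

definition vderiv :: "(real \<Rightarrow> complex) \<Rightarrow> real \<Rightarrow> complex" where
  "vderiv f x = vector_derivative f (at x)"

text \<open>\<open>C\<^sub>0\<^sup>\<infinity>(\<real>)\<close>: all iterated derivatives are differentiable, and the support is compact.\<close>

definition test_function :: "(real \<Rightarrow> complex) \<Rightarrow> bool" where
  "test_function f \<longleftrightarrow>
     (\<forall>n x. (vderiv ^^ n) f differentiable at x) \<and> compact (closure {x. f x \<noteq> 0})"

definition minimal_schroedinger :: "(real \<Rightarrow> complex) \<Rightarrow> (L2R \<times> L2R) set" where
  "minimal_schroedinger V =
     {(abs_L2R f, abs_L2R (\<lambda>x. - vderiv (vderiv f) x + V x * f x)) |f. test_function f}"

definition multiplication_op :: "(real \<Rightarrow> complex) \<Rightarrow> (L2R \<times> L2R) set" where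
  "multiplication_op m =
     {(abs_L2R f, abs_L2R (\<lambda>x. m x * f x)) |f.
        square_integrable f \<and> square_integrable (\<lambda>x. m x * f x)}"

lemma L2_eq_refl_iff: "L2_eq f f \<longleftrightarrow> square_integrable f"
  by (auto simp: L2_eq_def)

lemma abs_L2R_eq_iff:
  assumes "square_integrable f" "square_integrable g"
  shows "abs_L2R f = abs_L2R g \<longleftrightarrow> (AE x in lebesgue. f x = g x)"
  using Quotient_rel_abs2[OF Quotient_L2R] Quotient3_rel[OF Quotient3_L2R, of f g] assms
  by (auto simp: L2_eq_def)

lemma cinner_abs_L2R:
  assumes "square_integrable f" "square_integrable g"
  shows "cinner (abs_L2R f) (abs_L2R g) = integral\<^sup>L lebesgue (\<lambda>x. f x * cnj (g x))"
  using assms by (simp add: cinner_L2R.abs_eq L2_eq_refl_iff)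

lemma single_valued_multiplication_op: "single_valued (multiplication_op m)"
proof (rule single_valuedI)
  fix u v w assume "(u, v) \<in> multiplication_op m" "(u, w) \<in> multiplication_op m"
  then obtain f g where *: "square_integrable f" "square_integrable g"
      "square_integrable (\<lambda>x. m x * f x)" "square_integrable (\<lambda>x. m x * g x)"
      "u = abs_L2R f" "u = abs_L2R g" "v = abs_L2R (\<lambda>x. m x * f x)" "w = abs_L2R (\<lambda>x. m x * g x)"
    by (auto simp: multiplication_op_def)
  then have "AE x in lebesgue. f x = g x"
    using abs_L2R_eq_iff by metis
  then have "AE x in lebesgue. m x * f x = m x * g x"
    by auto
  with * show "v = w"
    by (simp add: abs_L2R_eq_iff)
qed

lemma Domain_multiplication_op:
  assumes [measurable]: "m \<in> borel_measurable lebesgue" and bd: "\<And>x. norm (m x) \<le> C"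
  shows "Domain (multiplication_op m) = UNIV"
proof -
  have "u \<in> Domain (multiplication_op m)" for u
  proof -
    obtain f where f: "square_integrable f" "u = abs_L2R f"
      by (induction u rule: L2R.abs_induct) (auto simp: L2_eq_refl_iff)
    then have [measurable]: "f \<in> borel_measurable lebesgue"
      and i: "integrable lebesgue (\<lambda>x. C\<^sup>2 * (norm (f x))\<^sup>2)"
      by (auto simp: square_integrable_def)
    have "integrable lebesgue (\<lambda>x. (norm (m x * f x))\<^sup>2)"
      by (rule Bochner_Integration.integrable_bound[OF i])
         (auto simp: norm_mult power_mult_distrib intro!: mult_right_mono power_mono bd)
    then have "square_integrable (\<lambda>x. m x * f x)"
      by (simp add: square_integrable_def)
    with f show ?thesis
      by (auto simp: multiplication_op_def)
  qed
  then show ?thesis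
    by auto
qed

lemma test_function_continuous:
  assumes "test_function f"
  shows "continuous_on UNIV ((vderiv ^^ n) f)"
  using assms by (auto simp: test_function_def continuous_on_eq_continuous_within
      intro!: differentiable_imp_continuous_within)

lemma test_function_vderiv:
  assumes "test_function f"
  shows "test_function (vderiv f)"
proof -
  have "vderiv f x = 0" if "x \<notin> closure {x. f x \<noteq> 0}" for x
  proof -
    have "(f has_vector_derivative 0) (at x)"
      by (rule has_vector_derivative_transform_within_open[where S = "- closure {x. f x \<noteq> 0}" and f = "\<lambda>_. 0"])
         (use that closure_subset[of "{x. f x \<noteq> 0}"] in auto)
    then show ?thesis
      by (simp add: vderiv_def vector_derivative_at)
  qed
  then have "closure {x. vderiv f x \<noteq> 0} \<subseteq> closure {x. f x \<noteq> 0}"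
    by (intro closure_minimal) auto
  moreover have "compact (closure {x. f x \<noteq> 0})"
    using assms by (simp add: test_function_def)
  ultimately have "compact (closure {x. vderiv f x \<noteq> 0})"
    by (meson closed_closure compact_Int_closed compact_closure bounded_subset compact_imp_bounded closure_subset order.trans)
  moreover have "(vderiv ^^ n) (vderiv f) differentiable at x" for n x
    using assms unfolding test_function_def by (metis funpow_Suc_right comp_apply)
  ultimately show ?thesis
    by (simp add: test_function_def)
qed

lemma test_function_bound:
  assumes "test_function f"
  obtains K M where "compact K" "\<And>x. x \<notin> K \<Longrightarrow> f x = 0" "\<And>x. norm (f x) \<le> M"
proof -
  define K where "K = closure {x. f x \<noteq> 0}"
  have K: "compact K"
    using assms by (simp add: test_function_def K_def)
  have out: "f x = 0" if "x \<notin> K" for x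
    using that closure_subset[of "{x. f x \<noteq> 0}"] by (auto simp: K_def)
  have "continuous_on K f"
    using test_function_continuous[OF assms, of 0] continuous_on_subset by fastforce
  then have "bounded (f ` K)"
    using K compact_continuous_image compact_imp_bounded by blast
  then obtain M where M: "\<And>x. x \<in> K \<Longrightarrow> norm (f x) \<le> M"
    by (auto simp: bounded_iff)
  have "norm (f x) \<le> max M 0" for x
    using M[of x] out[of x] by (cases "x \<in> K") auto
  with K out show ?thesis
    using that by blast
qed

lemma square_integrable_mult_test_function:
  assumes "locally_square_integrable V" "test_function f"
  shows "square_integrable (\<lambda>x. V x * f x)"
proof -
  obtain K M where K: "compact K" "\<And>x. x \<notin> K \<Longrightarrow> f x = 0" and M: "\<And>x. norm (f x) \<le> M"
    using test_function_bound[OF assms(2)] by blast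
  have [measurable]: "V \<in> borel_measurable lebesgue"
    using assms by (simp add: locally_square_integrable_def)
  have "f \<in> borel_measurable borel"
    using test_function_continuous[OF assms(2), of 0] by (simp add: borel_measurable_continuous_onI)
  then have [measurable]: "f \<in> borel_measurable lebesgue"
    by (simp add: measurable_completion)
  have i: "integrable lebesgue (\<lambda>x. M\<^sup>2 * (indicator K x *\<^sub>R (norm (V x))\<^sup>2))"
    using assms K by (auto simp: locally_square_integrable_def set_integrable_def)
  have "(norm (V x * f x))\<^sup>2 \<le> M\<^sup>2 * (indicator K x *\<^sub>R (norm (V x))\<^sup>2)" for x
    using K(2)[of x] M[of x]
    by (cases "x \<in> K")
       (auto simp: norm_mult power_mult_distrib mult.commute[of "M\<^sup>2"]
             intro!: mult_left_mono power_mono)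
  then have "integrable lebesgue (\<lambda>x. (norm (V x * f x))\<^sup>2)"
    by (intro Bochner_Integration.integrable_bound[OF i]) auto
  then show ?thesis
    by (simp add: square_integrable_def)
qed

lemma locally_square_integrable_one: "locally_square_integrable (\<lambda>x. 1)"
  unfolding locally_square_integrable_def set_integrable_def
  by (auto intro!: integrable_real_indicator
      dest: lmeasurable_compact simp: fmeasurable_def simp del: emeasure_completion)

lemma minimal_schroedinger_square_integrable:
  assumes "locally_square_integrable V" "test_function f"
  shows "square_integrable f"
    and "square_integrable (\<lambda>x. - vderiv (vderiv f) x + V x * f x)"
proof -
  have *: "square_integrable g" if "test_function g" for g
    using square_integrable_mult_test_function[OF locally_square_integrable_one that] by simp
  show "square_integrable f"
    using * assms(2) by blast
  show "square_integrable (\<lambda>x. - vderiv (vderiv f) x + V x * f x)"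
    using assms
    by (intro square_integrable_add square_integrable_uminus *
        square_integrable_mult_test_function test_function_vderiv)
qed

text \<open>\<^const>\<open>Arg\<close> takes values in \<open>(-\<pi>, \<pi>]\<close> and \<^term>\<open>Arg 0 = 0\<close>, so that for \<open>\<theta> \<ge> 0\<close>
  the sector is closed and contains \<open>0\<close>.\<close>

definition sector :: "real \<Rightarrow> complex set" where
  "sector \<theta> = {z. \<bar>Arg z\<bar> \<le> \<theta>}"

end

theory Submission
  imports Defs
begin

text \<open>
  For a test function \<open>f\<close>, integration by parts against \<open>B\<close>, whose values have real part bounded
  below by a positive constant and which rotates the sectors at both ends into \<open>S\<^sub>\<theta>\<close>, bounds
  \<open>\<parallel>f'\<parallel>\<^sup>2 + \<integral> |V| |f|\<^sup>2\<close> by \<open>Re \<langle>BTf, f\<rangle> + C \<parallel>f\<parallel>\<^sup>2\<close>. As \<open>|V| \<rightarrow> \<infinity>\<close>, the mass of \<open>f\<close> outside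
  a large interval is small relative to the right-hand side; inside, the Poincare inequality on a
  fine subdivision controls \<open>f\<close> by \<open>f'\<close> and finitely many functionals \<open>\<langle>f, g\<^sub>k\<rangle>\<close>. Hence
  \<open>\<parallel>u\<parallel>\<^sup>2 \<le> \<epsilon> (Re \<langle>BTu, u\<rangle> + C \<parallel>u\<parallel>\<^sup>2) + D \<Sum>\<^sub>k |\<langle>u, g\<^sub>k\<rangle>|\<^sup>2\<close>, a condition that is closed in the graph and so
  passes to \<open>dom(T)\<close>. A normalised weakly null sequence with bounded \<open>\<langle>BTx\<^sub>n, x\<^sub>n\<rangle>\<close> violates it for
  small \<open>\<epsilon>\<close>. All three sets require such a sequence, since \<open>B\<close> is bounded.
\<close>

section \<open>Complex inner products through real ones\<close>

text \<open>Since Re (- \<i> z) = Im z, both components of \<open>cinner\<close> are real inner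
  products, to which the library facts on \<open>inner\<close> apply.\<close>

lemma cinner_eq_inner:
  fixes x y :: "'a::complex_inner"
  shows "cinner x y = Complex (inner x y) (inner (- \<i> *\<^sub>C x) y)"
  by (simp add: complex_eq_iff inner_eq_Re_cinner cinner_scaleC_left)

lemma norm_scaleC_uminus_i:
  fixes x :: "'a::complex_inner"
  shows "norm (- \<i> *\<^sub>C x) = norm x"
proof -
  have "cinner (- \<i> *\<^sub>C x) (- \<i> *\<^sub>C x) = - \<i> * cnj (cinner (- \<i> *\<^sub>C x) x)"
    by (subst cinner_scaleC_left, subst cinner_commute) (rule refl)
  also have "\<dots> = - \<i> * cnj (- \<i>) * cnj (cinner x x)"
    by (simp add: cinner_scaleC_left)
  also have "\<dots> = cinner x x"
    by (subst (2) cinner_commute) simp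
  finally show ?thesis
    by (simp add: norm_eq_sqrt_inner inner_eq_Re_cinner)
qed

text \<open>The factor 2 comes from applying the real Cauchy-Schwarz inequality to the real and
  imaginary parts separately; any constant serves the boundedness arguments below.\<close>

lemma norm_cinner_le:
  fixes x y :: "'a::complex_inner"
  shows "norm (cinner x y) \<le> 2 * (norm x * norm y)"
proof -
  have "norm (cinner x y) \<le> \<bar>Re (cinner x y)\<bar> + \<bar>Im (cinner x y)\<bar>"
    by (rule cmod_le)
  also have "\<dots> \<le> norm x * norm y + norm (- \<i> *\<^sub>C x) * norm y"
    unfolding cinner_eq_inner complex.sel by (intro add_mono Cauchy_Schwarz_ineq2)
  finally show ?thesis
    by (simp only: norm_scaleC_uminus_i)
qed

text \<open>This makes inequalities in \<open>cinner\<close> closed conditions, so that they survive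
  the closure of a graph. It rests on multiplication by - \<i> being an isometry.\<close>

lemma continuous_on_cinner [continuous_intros]:
  fixes f g :: "'b::topological_space \<Rightarrow> 'a::complex_inner"
  assumes "continuous_on S f" "continuous_on S g"
  shows "continuous_on S (\<lambda>x. cinner (f x) (g x))"
proof -
  have "bounded_linear (\<lambda>x::'a. - \<i> *\<^sub>C x)"
  proof (rule bounded_linear_intro[where K = 1])
    show "- \<i> *\<^sub>C (r *\<^sub>R x) = r *\<^sub>R (- \<i> *\<^sub>C x)" for r and x :: 'a
      by (simp add: scaleC_scaleC mult.commute flip: scaleC_of_real)
  qed (simp_all add: scaleC_add_right norm_scaleC_uminus_i)
  then have "continuous_on S (\<lambda>x. - \<i> *\<^sub>C f x)"
    using assms(1) by (rule bounded_linear.continuous_on)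
  then show ?thesis
    unfolding cinner_eq_inner Complex_eq by (intro continuous_intros assms)
qed

section \<open>Square-integrable functions and test functions\<close>

lemma integrable_indicator_mult:
  fixes g :: "real \<Rightarrow> real"
  assumes "integrable lebesgue g" "A \<in> sets borel"
  shows "integrable lebesgue (\<lambda>x. indicator A x * g x)"
proof -
  have "A \<in> sets lebesgue"
    using assms(2) by (intro sets_completionI_sets) simp
  from integrable_mult_indicator[OF this assms(1)] show ?thesis
    by simp
qed

lemma square_integrable_bounded_mult:
  assumes "m \<in> borel_measurable lebesgue" "\<And>x. norm (m x) \<le> C" "square_integrable f"
  shows "square_integrable (\<lambda>x. m x * f x)"
proof -
  have [measurable]: "m \<in> borel_measurable lebesgue" "f \<in> borel_measurable lebesgue"
    and i: "integrable lebesgue (\<lambda>x. C\<^sup>2 * (norm (f x))\<^sup>2)"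
    using assms by (auto simp: square_integrable_def)
  have "integrable lebesgue (\<lambda>x. (norm (m x * f x))\<^sup>2)"
    by (rule Bochner_Integration.integrable_bound[OF i])
       (auto simp: norm_mult power_mult_distrib intro!: mult_right_mono power_mono assms)
  then show ?thesis
    by (simp add: square_integrable_def)
qed

lemma square_integrable_test_function:
  assumes "test_function f"
  shows "square_integrable f"
  using square_integrable_mult_test_function[OF locally_square_integrable_one assms] by simp

lemma test_function_has_vector_derivative:
  assumes "test_function f"
  shows "(f has_vector_derivative vderiv f x) (at x)"
proof -
  have "f differentiable at x"
    using assms unfolding test_function_def by (metis funpow_0)
  then show ?thesis
    by (simp add: vderiv_def vector_derivative_works)
qed

lemma continuous_on_test_function:
  assumes "test_function f"
  shows "continuous_on S f"
  by (rule continuous_on_subset[OF _ subset_UNIV])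
     (use test_function_continuous[OF assms, of 0] in simp)

lemma test_function_vanishes:
  assumes "test_function f"
  obtains R where "\<And>x. R \<le> \<bar>x\<bar> \<Longrightarrow> f x = 0"
proof -
  obtain K M where K: "compact K" "\<And>x. x \<notin> K \<Longrightarrow> f x = 0" and "\<And>x. norm (f x) \<le> M"
    using test_function_bound[OF assms] by blast
  obtain R where "\<And>x. x \<in> K \<Longrightarrow> \<bar>x\<bar> \<le> R"
    using compact_imp_bounded[OF K(1)] by (auto simp: bounded_iff)
  then have "f x = 0" if "R + 1 \<le> \<bar>x\<bar>" for x
    using K(2) that by force
  then show ?thesis
    by (rule that)
qed

lemma norm_L2R_abs:
  assumes "square_integrable f"
  shows "(norm (abs_L2R f))\<^sup>2 = integral\<^sup>L lebesgue (\<lambda>x. (norm (f x))\<^sup>2)"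
  using assms
  by (simp add: power2_norm_eq_inner inner_eq_Re_cinner cinner_abs_L2R integral_mult_cnj_self)

section \<open>Bounded multiplication operators\<close>

text \<open>A function in place of the graph \<open>multiplication_op m\<close>, so that norm bounds
  and continuity can be expressed. It is meaningful where the product is square integrable, which
  measurability and boundedness of \<open>m\<close> guarantee for every \<open>u\<close>.\<close>

definition mult_L2R :: "(real \<Rightarrow> complex) \<Rightarrow> L2R \<Rightarrow> L2R" where
  "mult_L2R m u = abs_L2R (\<lambda>x. m x * rep_L2R u x)"

lemma square_integrable_rep_L2R: "square_integrable (rep_L2R u)"
  using Quotient_rep_reflp[OF Quotient_L2R] by (simp add: L2_eq_refl_iff)

lemma abs_rep_L2R: "abs_L2R (rep_L2R u) = u"
  by (rule Quotient3_abs_rep[OF Quotient3_L2R])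

context
  fixes m :: "real \<Rightarrow> complex" and C :: real
  assumes m_measurable: "m \<in> borel_measurable lebesgue" and m_bound: "\<And>x. norm (m x) \<le> C"
begin

lemma square_integrable_m: "square_integrable f \<Longrightarrow> square_integrable (\<lambda>x. m x * f x)"
  by (rule square_integrable_bounded_mult[OF m_measurable m_bound])

lemma mult_L2R_graph: "(u, mult_L2R m u) \<in> multiplication_op m"
  unfolding multiplication_op_def mult_L2R_def
  using square_integrable_rep_L2R square_integrable_m abs_rep_L2R
  by (auto intro!: exI[of _ "rep_L2R u"])

lemma multiplication_op_iff: "(u, v) \<in> multiplication_op m \<longleftrightarrow> v = mult_L2R m u"
  using mult_L2R_graph single_valued_multiplication_op by (auto dest: single_valuedD)

lemma mult_L2R_abs:
  assumes "square_integrable f"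
  shows "mult_L2R m (abs_L2R f) = abs_L2R (\<lambda>x. m x * f x)"
proof -
  have "(abs_L2R f, abs_L2R (\<lambda>x. m x * f x)) \<in> multiplication_op m"
    using assms square_integrable_m by (auto simp: multiplication_op_def)
  then show ?thesis
    by (simp add: multiplication_op_iff)
qed

lemma norm_mult_L2R: "norm (mult_L2R m u) \<le> C * norm u"
proof -
  obtain f where f: "square_integrable f" "u = abs_L2R f"
    using square_integrable_rep_L2R abs_rep_L2R by metis
  have "0 \<le> C"
    using m_bound norm_ge_zero order.trans by blast
  have "(norm (mult_L2R m u))\<^sup>2 = integral\<^sup>L lebesgue (\<lambda>x. (norm (m x * f x))\<^sup>2)"
    using f by (simp add: mult_L2R_abs norm_L2R_abs square_integrable_m)
  also have "\<dots> \<le> integral\<^sup>L lebesgue (\<lambda>x. C\<^sup>2 * (norm (f x))\<^sup>2)"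
    using f square_integrable_m
    by (intro integral_mono)
       (auto simp: square_integrable_def norm_mult power_mult_distrib
             intro!: mult_right_mono power_mono m_bound)
  also have "\<dots> = (C * norm u)\<^sup>2"
    using f by (simp add: norm_L2R_abs power_mult_distrib)
  finally show ?thesis
    using \<open>0 \<le> C\<close> by (auto intro: power2_le_imp_le)
qed

lemma bounded_linear_mult_L2R: "bounded_linear (mult_L2R m)"
proof (rule bounded_linear_intro[where K = C])
  fix u v :: L2R and s :: real
  obtain f g where f: "square_integrable f" "u = abs_L2R f" and g: "square_integrable g" "v = abs_L2R g"
    using square_integrable_rep_L2R abs_rep_L2R by metis
  show "mult_L2R m (u + v) = mult_L2R m u + mult_L2R m v"
    using f g by (simp add: mult_L2R_abs plus_L2R.abs_eq L2_eq_refl_iff square_integrable_m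
        square_integrable_add distrib_left)
  show "mult_L2R m (s *\<^sub>R u) = s *\<^sub>R mult_L2R m u"
    using f by (simp add: mult_L2R_abs scaleR_L2R.abs_eq L2_eq_refl_iff square_integrable_m
        square_integrable_scale mult.left_commute)
  show "norm (mult_L2R m u) \<le> norm u * C"
    using norm_mult_L2R by (simp add: mult.commute)
qed

end

section \<open>Poincare inequalities on intervals\<close>

text \<open>Cauchy-Schwarz against the constant 1: expand the nonnegative integral of
  \<open>(g x - s)\<^sup>2\<close>, where \<open>s\<close> is the mean of \<open>g\<close>.\<close>

lemma power2_integral_le:
  fixes g :: "real \<Rightarrow> real"
  assumes "p < q" "continuous_on {p..q} g"
  shows "(integral {p..q} g)\<^sup>2 \<le> (q - p) * integral {p..q} (\<lambda>x. (g x)\<^sup>2)"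
proof -
  define s where "s = integral {p..q} g / (q - p)"
  have i: "g integrable_on {p..q}" "(\<lambda>x. (g x)\<^sup>2) integrable_on {p..q}"
    by (intro integrable_continuous_real continuous_intros assms)+
  have "0 \<le> integral {p..q} (\<lambda>x. (g x - s)\<^sup>2)"
    by (intro integral_nonneg integrable_continuous_real continuous_intros assms) auto
  also have "integral {p..q} (\<lambda>x. (g x - s)\<^sup>2)
      = integral {p..q} (\<lambda>x. (g x)\<^sup>2) - 2 * s * integral {p..q} g + s\<^sup>2 * (q - p)"
  proof (rule integral_unique)
    have "((\<lambda>x. (g x)\<^sup>2 - (2 * s) * g x + s\<^sup>2) has_integral
        integral {p..q} (\<lambda>x. (g x)\<^sup>2) - (2 * s) * integral {p..q} g + (q - p) *\<^sub>R s\<^sup>2) {p..q}"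
      using i assms(1) has_integral_const_real[of "s\<^sup>2" p q]
      by (intro has_integral_add has_integral_diff has_integral_mult_right integrable_integral) auto
    then show "((\<lambda>x. (g x - s)\<^sup>2) has_integral
        integral {p..q} (\<lambda>x. (g x)\<^sup>2) - 2 * s * integral {p..q} g + s\<^sup>2 * (q - p)) {p..q}"
      by (simp add: power2_diff algebra_simps)
  qed
  also have "\<dots> = integral {p..q} (\<lambda>x. (g x)\<^sup>2) - (integral {p..q} g)\<^sup>2 / (q - p)"
    using assms(1) by (simp add: s_def power2_eq_square)
  finally show ?thesis
    using assms(1) by (simp add: field_simps)
qed

text \<open>By the fundamental theorem of calculus, \<open>f\<close> oscillates on the interval by
  at most \<open>A\<close>, the integral of the modulus of its derivative. Hence each value is
  within \<open>A\<close> of the mean, and Cauchy-Schwarz bounds \<open>A\<^sup>2\<close>.\<close>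

lemma local_poincare:
  assumes f: "test_function f" and "p < q"
  shows "integral {p..q} (\<lambda>x. (norm (f x))\<^sup>2)
    \<le> 2 / (q - p) * (norm (integral {p..q} f))\<^sup>2 + 2 * (q - p)\<^sup>2 * integral {p..q} (\<lambda>x. (norm (vderiv f x))\<^sup>2)"
proof -
  define h where "h = q - p"
  define A where "A = integral {p..q} (\<lambda>x. norm (vderiv f x))"
  have h: "h > 0"
    using assms by (simp add: h_def)
  have c: "continuous_on S f" "continuous_on S (vderiv f)" for S
    using continuous_on_test_function f test_function_vderiv by auto
  have i: "f integrable_on {p..q}"
    by (intro integrable_continuous_real c)
  have A0: "0 \<le> A"
    unfolding A_def by (intro integral_nonneg integrable_continuous_real continuous_on_norm c) simp
  have A2: "A\<^sup>2 \<le> h * integral {p..q} (\<lambda>x. (norm (vderiv f x))\<^sup>2)"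
    unfolding A_def h_def by (rule power2_integral_le[OF assms(2) continuous_on_norm[OF c(2)]])
  have osc_less: "norm (f y - f x) \<le> A" if "x \<in> {p..q}" "y \<in> {p..q}" "x \<le> y" for x y
  proof -
    have "(vderiv f has_integral f y - f x) {x..y}"
      by (rule fundamental_theorem_of_calculus[OF that(3)])
         (rule has_vector_derivative_at_within[OF test_function_has_vector_derivative[OF f]])
    then have "f y - f x = integral {x..y} (vderiv f)"
      by (simp add: integral_unique)
    also have "norm \<dots> \<le> integral {x..y} (\<lambda>x. norm (vderiv f x))"
      by (rule integral_norm_bound_integral)
         (intro integrable_continuous_real continuous_on_norm c order.refl)+
    also have "\<dots> \<le> A"
      unfolding A_def
      by (rule integral_subset_le)
         (use that in \<open>auto intro: integrable_continuous_real continuous_on_norm c\<close>)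
    finally show ?thesis .
  qed
  have osc: "norm (f y - f x) \<le> A" if "x \<in> {p..q}" "y \<in> {p..q}" for x y
    using osc_less[OF that] osc_less[OF that(2,1)] by (cases "x \<le> y") (auto simp: norm_minus_commute)
  have pw: "(norm (f x))\<^sup>2 \<le> 2 / h\<^sup>2 * (norm (integral {p..q} f))\<^sup>2 + 2 * A\<^sup>2" if x: "x \<in> {p..q}" for x
  proof -
    \<comment> \<open>The difference between \<open>h\<close> times the value at \<open>x\<close>
      and the integral of \<open>f\<close> is the integral of \<open>f x - f y\<close> over
      \<open>y\<close>, so the oscillation bound applies under the integral.\<close>
    have "((\<lambda>_. f x) has_integral h *\<^sub>R f x) {p..q}"
      using has_integral_const_real[of "f x" p q] assms(2) by (simp add: h_def)
    then have "((\<lambda>y. f x - f y) has_integral (h *\<^sub>R f x - integral {p..q} f)) {p..q}"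
      by (intro has_integral_diff integrable_integral i)
    then have "norm (h *\<^sub>R f x - integral {p..q} f) \<le> A * h"
      using has_integral_bound_real[of A "{}" _ _ p q] osc x A0 assms by (auto simp: h_def)
    then have "h * norm (f x) \<le> norm (integral {p..q} f) + h * A"
      using norm_triangle_sub[of "h *\<^sub>R f x" "integral {p..q} f"] h by (simp add: mult.commute)
    then have "norm (f x) \<le> norm (integral {p..q} f) / h + A"
      using h by (simp add: field_simps)
    then have "(norm (f x))\<^sup>2 \<le> (norm (integral {p..q} f) / h + A)\<^sup>2"
      by (intro power_mono) auto
    also have "\<dots> \<le> 2 * (norm (integral {p..q} f) / h)\<^sup>2 + 2 * A\<^sup>2"
      using sum_squares_bound[of "norm (integral {p..q} f) / h" A] by (simp add: power2_sum)
    finally show ?thesis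
      by (simp add: power_divide)
  qed
  have "integral {p..q} (\<lambda>x. (norm (f x))\<^sup>2)
      \<le> integral {p..q} (\<lambda>x. 2 / h\<^sup>2 * (norm (integral {p..q} f))\<^sup>2 + 2 * A\<^sup>2)"
    using pw by (intro integral_le integrable_continuous_real continuous_intros c) auto
  also have "\<dots> = 2 / h * (norm (integral {p..q} f))\<^sup>2 + 2 * h * A\<^sup>2"
    using h assms by (simp add: h_def[symmetric] field_simps power2_eq_square)
  also have "\<dots> \<le> 2 / h * (norm (integral {p..q} f))\<^sup>2 + 2 * h * (h * integral {p..q} (\<lambda>x. (norm (vderiv f x))\<^sup>2))"
    using A2 h by (intro add_left_mono mult_left_mono) auto
  finally show ?thesis
    unfolding h_def[symmetric] by (simp add: power2_eq_square mult.assoc)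
qed

text \<open>The local inequality is summed over \<open>N\<close> adjacent cells of length
  \<open>h\<close>. The factor of the derivative term stays proportional to \<open>h\<^sup>2\<close>
  whatever \<open>N\<close> is, so refining the cells makes it small.\<close>

lemma subdivided_poincare:
  assumes f: "test_function f" and h: "0 < h"
  shows "integral {p..p + real N * h} (\<lambda>x. (norm (f x))\<^sup>2)
    \<le> 2 / h * (\<Sum>k<N. (norm (integral {p + real k * h..p + real (Suc k) * h} f))\<^sup>2)
      + 2 * h\<^sup>2 * integral {p..p + real N * h} (\<lambda>x. (norm (vderiv f x))\<^sup>2)"
proof (induction N)
  case (Suc N)
  have c: "continuous_on S f" "continuous_on S (vderiv f)" for S
    using continuous_on_test_function f test_function_vderiv by auto
  have split: "integral {p..p + real (Suc N) * h} (\<lambda>x. (norm (g x))\<^sup>2)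
      = integral {p..p + real N * h} (\<lambda>x. (norm (g x))\<^sup>2)
        + integral {p + real N * h..p + real (Suc N) * h} (\<lambda>x. (norm (g x))\<^sup>2)"
    if "\<And>S. continuous_on S g" for g :: "real \<Rightarrow> complex"
    using h that
    by (intro Henstock_Kurzweil_Integration.integral_combine[symmetric] integrable_continuous_real continuous_intros)
       (auto intro!: mult_right_mono)
  have "p + real N * h < p + real (Suc N) * h" "p + real (Suc N) * h - (p + real N * h) = h"
    using h by (auto simp: algebra_simps)
  then show ?case
    unfolding split[OF c(1)] split[OF c(2)]
    using Suc local_poincare[OF f, of "p + real N * h" "p + real (Suc N) * h"]
    by (simp add: algebra_simps)
qed simp

section \<open>Integration by parts with a weight\<close>

text \<open>\<open>G\<close> is the derivative, off \<open>S\<close>, of the compactly supported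
  continuous function \<open>F\<close> with values \<open>m x * vderiv f x * cnj (f x)\<close>.
  Continuity of \<open>F\<close> allows finitely many exceptional points in the fundamental theorem,
  so the weight may have corners.\<close>

lemma weighted_integration_by_parts:
  fixes m m' :: "real \<Rightarrow> complex"
  assumes f: "test_function f" and S: "finite S" and m: "continuous_on UNIV m" "\<And>x. norm (m x) \<le> C"
    and m': "m' \<in> borel_measurable lebesgue" "\<And>x. norm (m' x) \<le> L"
    and der: "\<forall>x. x \<notin> S \<longrightarrow> (m has_vector_derivative m' x) (at x)"
  defines "G \<equiv> \<lambda>x. m x * vderiv (vderiv f) x * cnj (f x) + m' x * vderiv f x * cnj (f x)
    + m x * vderiv f x * cnj (vderiv f x)"
  shows "integrable lebesgue G" "integral\<^sup>L lebesgue G = 0"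
proof -
  note f' = test_function_vderiv[OF f]
  note f'' = test_function_vderiv[OF f']
  have "m \<in> borel_measurable lebesgue"
    using m(1) by (simp add: borel_measurable_continuous_onI measurable_completion)
  then show G: "integrable lebesgue G"
    unfolding G_def using m m' f f' f''
    by (intro Bochner_Integration.integrable_add integrable_mult_cnj square_integrable_bounded_mult
        square_integrable_test_function)
  obtain R1 where R1: "\<And>x. R1 \<le> \<bar>x\<bar> \<Longrightarrow> f x = 0"
    using test_function_vanishes[OF f] by blast
  obtain R2 where R2: "\<And>x. R2 \<le> \<bar>x\<bar> \<Longrightarrow> vderiv f x = 0"
    using test_function_vanishes[OF f'] by blast
  \<comment> \<open>The 0 ensures \<open>- R \<le> R\<close>; outside the interval both
    \<open>f\<close> and its derivative vanish.\<close>
  define R where "R = max 0 (max R1 R2)"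
  define F where "F = (\<lambda>x. (m x * vderiv f x) * cnj (f x))"
  have "(F has_vector_derivative G x) (at x)" if "x \<notin> S" for x
  proof -
    have "(F has_vector_derivative (m x * vderiv f x) * cnj (vderiv f x)
        + (m x * vderiv (vderiv f) x + m' x * vderiv f x) * cnj (f x)) (at x)"
      unfolding F_def
      by (intro has_vector_derivative_mult bounded_linear.has_vector_derivative[OF bounded_linear_cnj]
          test_function_has_vector_derivative f f' der[rule_format, OF that])
    then show ?thesis
      by (simp add: G_def algebra_simps)
  qed
  moreover have "continuous_on {-R..R} F"
    unfolding F_def
    by (intro continuous_on_mult continuous_on_cnj continuous_on_subset[OF m(1)]
        continuous_on_test_function[OF f] continuous_on_test_function[OF f']) auto
  ultimately have "(G has_integral F R - F (- R)) {-R..R}"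
    by (intro fundamental_theorem_of_calculus_strong[OF S]) (auto simp: R_def)
  moreover have "F R = 0" "F (- R) = 0"
    using R1[of R] R1[of "- R"] by (auto simp: F_def R_def)
  ultimately have "(G has_integral 0) UNIV"
    using R1 R2 by (auto elim!: has_integral_on_superset simp: G_def R_def)
  with has_integral_integral_lebesgue[OF G] show "integral\<^sup>L lebesgue G = 0"
    by (rule has_integral_unique)
qed

section \<open>Energy and compactness estimates\<close>

text \<open>These assumptions isolate what the estimates use. Sectors enter only through
  \<open>coercive\<close>: each level \<open>\<kappa>\<close> has its own radius, but the lower
  bound \<open>- r\<close> inside is the same for all levels.\<close>

context
  fixes V m m' :: "real \<Rightarrow> complex" and S :: "real set" and c L r :: real
  assumes V: "locally_square_integrable V"
    and m: "continuous_on UNIV m" "\<And>x. norm (m x) \<le> 1" "\<And>x. c \<le> Re (m x)" "0 < c"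
    and S: "finite S"
    and m': "m' \<in> borel_measurable lebesgue" "\<And>x. norm (m' x) \<le> L"
      "\<forall>x. x \<notin> S \<longrightarrow> (m has_vector_derivative m' x) (at x)"
    and coercive: "\<And>\<kappa>. \<exists>R. AE x in lebesgue. (if \<bar>x\<bar> \<le> R then - r else \<kappa>) \<le> Re (m x * V x)"
    and r: "0 \<le> r"
begin

lemma measurable_m: "m \<in> borel_measurable lebesgue"
  using m(1) by (simp add: borel_measurable_continuous_onI measurable_completion)

text \<open>Integration by parts trades the second derivative for \<open>m\<close> times the squared
  modulus of \<open>vderiv f\<close> and a cross term with \<open>m'\<close>. The first has real
  part at least \<open>c\<close> times that square, half of which absorbs the cross term; the
  potential contributes \<open>\<kappa>\<close> outside the interval and at least \<open>- r\<close>
  inside.\<close>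

lemma energy_estimate:
  assumes f: "test_function f"
    and ae: "AE x in lebesgue. (if \<bar>x\<bar> \<le> R then - r else \<kappa>) \<le> Re (m x * V x)"
    and "0 \<le> \<kappa>"
  defines "u \<equiv> abs_L2R f" and "v \<equiv> abs_L2R (\<lambda>x. - vderiv (vderiv f) x + V x * f x)"
  shows "c / 2 * integral\<^sup>L lebesgue (\<lambda>x. (norm (vderiv f x))\<^sup>2)
      + \<kappa> * integral\<^sup>L lebesgue (\<lambda>x. indicator (- {-R..R}) x * (norm (f x))\<^sup>2)
    \<le> Re (cinner (mult_L2R m v) u) + (r + L\<^sup>2 / (2 * c)) * (norm u)\<^sup>2"
proof -
  note f' = test_function_vderiv[OF f]
  define Tf where "Tf = (\<lambda>x. - vderiv (vderiv f) x + V x * f x)"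
  define G where "G = (\<lambda>x. m x * vderiv (vderiv f) x * cnj (f x) + m' x * vderiv f x * cnj (f x)
    + m x * vderiv f x * cnj (vderiv f x))"
  note G = weighted_integration_by_parts[OF f S m(1,2) m', folded G_def]
  have sf: "square_integrable f" "square_integrable (vderiv f)" "square_integrable Tf"
    unfolding Tf_def
    by (rule square_integrable_test_function[OF f] square_integrable_test_function[OF f']
        minimal_schroedinger_square_integrable(2)[OF V f])+
  have smT: "square_integrable (\<lambda>x. m x * Tf x)"
    by (rule square_integrable_bounded_mult[OF measurable_m m(2) sf(3)])
  have i: "integrable lebesgue (\<lambda>x. (norm (f x))\<^sup>2)" "integrable lebesgue (\<lambda>x. (norm (vderiv f x))\<^sup>2)"
    using sf by (auto simp: square_integrable_def)
  have io: "integrable lebesgue (\<lambda>x. indicator (- {-R..R}) x * (norm (f x))\<^sup>2)"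
    by (rule integrable_indicator_mult[OF i(1)]) simp
  define C where "C = r + L\<^sup>2 / (2 * c)"
  have iT: "integrable lebesgue (\<lambda>x. m x * Tf x * cnj (f x))"
    by (rule integrable_mult_cnj[OF smT sf(1)])
  have "Re (cinner (mult_L2R m v) u) = Re (integral\<^sup>L lebesgue (\<lambda>x. m x * Tf x * cnj (f x)))"
    unfolding u_def v_def Tf_def[symmetric]
    by (simp add: mult_L2R_abs[OF measurable_m m(2)] cinner_abs_L2R sf smT)
  \<comment> \<open>Adding \<open>G\<close>, whose integral is 0, cancels the second derivative
    pointwise.\<close>
  also have "\<dots> = Re (integral\<^sup>L lebesgue (\<lambda>x. m x * Tf x * cnj (f x) + G x))"
    using G iT by simp
  also have "\<dots> = integral\<^sup>L lebesgue (\<lambda>x. Re (m x * Tf x * cnj (f x) + G x))"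
    using G iT by (intro integral_Re[symmetric] Bochner_Integration.integrable_add)
  finally have eq: "Re (cinner (mult_L2R m v) u) = integral\<^sup>L lebesgue (\<lambda>x. Re (m x * Tf x * cnj (f x) + G x))" .
  have pw: "c / 2 * (norm (vderiv f x))\<^sup>2 + \<kappa> * (indicator (- {-R..R}) x * (norm (f x))\<^sup>2)
      - C * (norm (f x))\<^sup>2 \<le> Re (m x * Tf x * cnj (f x) + G x)"
    if "(if \<bar>x\<bar> \<le> R then - r else \<kappa>) \<le> Re (m x * V x)" for x
  proof -
    have "m x * Tf x * cnj (f x) + G x = (m x * V x) * (f x * cnj (f x)) + m' x * vderiv f x * cnj (f x)
      + m x * (vderiv f x * cnj (vderiv f x))"
      by (simp add: Tf_def G_def algebra_simps)
    also have "Re \<dots> = Re (m x * V x) * (norm (f x))\<^sup>2 + Re (m' x * vderiv f x * cnj (f x))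
      + Re (m x) * (norm (vderiv f x))\<^sup>2"
      unfolding complex_norm_square[symmetric] by simp
    finally have e: "Re (m x * Tf x * cnj (f x) + G x) = \<dots>" .
    \<comment> \<open>One formula covers both cases: outside the interval an amount \<open>r\<close>
      is given away.\<close>
    have "(\<kappa> * indicator (- {-R..R}) x - r) \<le> Re (m x * V x)"
      using that r by (auto simp: indicator_def split: if_splits)
    then have 1: "(\<kappa> * indicator (- {-R..R}) x - r) * (norm (f x))\<^sup>2 \<le> Re (m x * V x) * (norm (f x))\<^sup>2"
      by (intro mult_right_mono) auto
    have 2: "c * (norm (vderiv f x))\<^sup>2 \<le> Re (m x) * (norm (vderiv f x))\<^sup>2"
      using m(3) by (intro mult_right_mono) auto
    have "\<bar>Re (m' x * vderiv f x * cnj (f x))\<bar> \<le> norm (m' x) * (norm (vderiv f x) * norm (f x))"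
      using abs_Re_le_cmod[of "m' x * vderiv f x * cnj (f x)"] by (simp add: norm_mult mult.assoc)
    also have "\<dots> \<le> L * (norm (vderiv f x) * norm (f x))"
      using m'(2) by (intro mult_right_mono) auto
    also have "\<dots> \<le> c / 2 * (norm (vderiv f x))\<^sup>2 + L\<^sup>2 / (2 * c) * (norm (f x))\<^sup>2"
    proof -
      \<comment> \<open>Young's inequality, weighted so that the derivative takes exactly half of
        \<open>c\<close>.\<close>
      have "0 \<le> (c * norm (vderiv f x) - L * norm (f x))\<^sup>2 / (2 * c)"
        using m(4) by simp
      also have "\<dots> = c / 2 * (norm (vderiv f x))\<^sup>2 + L\<^sup>2 / (2 * c) * (norm (f x))\<^sup>2
          - L * (norm (vderiv f x) * norm (f x))"
        using m(4) by (simp add: field_simps power2_eq_square)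
      finally show ?thesis
        by simp
    qed
    finally show ?thesis
      unfolding e C_def using 1 2 by (simp add: algebra_simps)
  qed
  have "integral\<^sup>L lebesgue (\<lambda>x. c / 2 * (norm (vderiv f x))\<^sup>2
        + \<kappa> * (indicator (- {-R..R}) x * (norm (f x))\<^sup>2) - C * (norm (f x))\<^sup>2)
      \<le> Re (cinner (mult_L2R m v) u)"
    unfolding eq using i io iT G(1) ae pw
    by (intro integral_mono_AE integrable_Re Bochner_Integration.integrable_add
        Bochner_Integration.integrable_diff integrable_mult_right) (auto elim!: eventually_mono)
  also have "integral\<^sup>L lebesgue (\<lambda>x. c / 2 * (norm (vderiv f x))\<^sup>2
        + \<kappa> * (indicator (- {-R..R}) x * (norm (f x))\<^sup>2) - C * (norm (f x))\<^sup>2)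
      = c / 2 * integral\<^sup>L lebesgue (\<lambda>x. (norm (vderiv f x))\<^sup>2)
      + \<kappa> * integral\<^sup>L lebesgue (\<lambda>x. indicator (- {-R..R}) x * (norm (f x))\<^sup>2) - C * (norm u)\<^sup>2"
    using i io sf by (simp add: u_def norm_L2R_abs)
  finally show ?thesis
    by (simp add: C_def)
qed

text \<open>A quantitative substitute for a compact embedding. The mass outside a large interval is
  controlled by the energy estimate at level \<open>1 / \<epsilon>\<close>. Inside, the Poincare
  inequality on short cells leaves a small multiple of the kinetic energy and finitely many
  functionals. These depend on \<open>\<epsilon>\<close> but not on the pair
  \<open>(u, v)\<close>.\<close>

lemma compactness_estimate:
  assumes "0 < \<epsilon>"
  shows "\<exists>(g :: nat \<Rightarrow> L2R) N D. \<forall>u v. (u, v) \<in> closure (minimal_schroedinger V) \<longrightarrow>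
      (norm u)\<^sup>2 \<le> \<epsilon> * (Re (cinner (mult_L2R m v) u) + (r + L\<^sup>2 / (2 * c)) * (norm u)\<^sup>2)
        + D * (\<Sum>k<N. (norm (cinner u (g k)))\<^sup>2)"
proof -
  define C where "C = r + L\<^sup>2 / (2 * c)"
  obtain R0 where R0: "AE x in lebesgue. (if \<bar>x\<bar> \<le> R0 then - r else 1 / \<epsilon>) \<le> Re (m x * V x)"
    using coercive by blast
  \<comment> \<open>The radius must be positive for the subdivision. Enlarging it keeps the bound
    because \<open>- r \<le> 1 / \<epsilon>\<close>.\<close>
  define R where "R = max R0 1"
  have R: "0 < R"
    by (simp add: R_def)
  have "- r \<le> 1 / \<epsilon>"
    using r assms by (simp add: order.trans[of _ 0])
  then have ae: "AE x in lebesgue. (if \<bar>x\<bar> \<le> R then - r else 1 / \<epsilon>) \<le> Re (m x * V x)"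
    by (intro eventually_mono[OF R0]) (auto simp: R_def split: if_splits)
  \<comment> \<open>For \<open>h < \<delta>\<close>, the 1 gives \<open>h\<^sup>2 \<le> h\<close>,
    and the other entry then gives \<open>2 * h\<^sup>2 \<le> \<epsilon> * (c / 2)\<close>, the
    kinetic coefficient that the energy estimate supplies.\<close>
  define \<delta> where "\<delta> = min 1 (\<epsilon> * c / 4)"
  have \<delta>: "0 < \<delta>" "\<delta> \<le> 1" "\<delta> \<le> \<epsilon> * c / 4"
    using assms m(4) by (auto simp: \<delta>_def)
  obtain N where N: "0 < N" "2 * R / \<delta> < real N"
    using reals_Archimedean2[of "2 * R / \<delta>"] \<delta> R by (metis divide_pos_pos gr0I less_trans mult_pos_pos not_less_iff_gr_or_eq of_nat_0 zero_less_numeral)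
  define h where "h = 2 * R / real N"
  have h: "0 < h" "h < \<delta>" "- R + real N * h = R"
    using N R \<delta> by (auto simp: h_def field_simps)
  have "h\<^sup>2 \<le> h * 1"
    using h \<delta> unfolding power2_eq_square by (intro mult_left_mono) auto
  then have h2: "2 * h\<^sup>2 \<le> \<epsilon> * (c / 2)"
    using h \<delta> by simp
  define I where "I = (\<lambda>k. {- R + real k * h..- R + real (Suc k) * h})"
  \<comment> \<open>Pairing with the indicator of a cell gives the integral over that cell, the
    quantity in the Poincare inequality.\<close>
  define g where "g = (\<lambda>k. abs_L2R (indicator (I k)))"
  define P where "P = (\<lambda>(u, v). (norm u)\<^sup>2 \<le> \<epsilon> * (Re (cinner (mult_L2R m v) u) + C * (norm u)\<^sup>2)
        + 2 / h * (\<Sum>k<N. (norm (cinner u (g k)))\<^sup>2))"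
  have sI: "square_integrable (indicator (I k))" for k
  proof -
    have "(\<lambda>x. (norm (indicator (I k) x :: complex))\<^sup>2) = indicator (I k)"
      by (auto simp: indicator_def)
    then show ?thesis
      by (auto simp: square_integrable_def I_def emeasure_lborel_Icc_eq intro!: integrable_real_indicator borel_measurable_indicator)
  qed
  have "P (abs_L2R f, abs_L2R (\<lambda>x. - vderiv (vderiv f) x + V x * f x))" if f: "test_function f" for f
  proof -
    note f' = test_function_vderiv[OF f]
    have sf: "square_integrable f" "square_integrable (vderiv f)"
      using f f' by (simp_all add: square_integrable_test_function)
    then have i: "integrable lebesgue (\<lambda>x. (norm (f x))\<^sup>2)" "integrable lebesgue (\<lambda>x. (norm (vderiv f x))\<^sup>2)"
      by (auto simp: square_integrable_def)
    have io: "integrable lebesgue (\<lambda>x. indicator (- {-R..R}) x * (norm (f x))\<^sup>2)"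
      "integrable lebesgue (\<lambda>x. indicator {-R..R} x * (norm (f x))\<^sup>2)"
      by (rule integrable_indicator_mult[OF i(1)]; simp)+
    have inI: "cinner (abs_L2R f) (g k) = integral (I k) f" for k
    proof -
      have int: "integrable lebesgue (\<lambda>x. f x * cnj (indicator (I k) x))"
        by (rule integrable_mult_cnj[OF sf(1) sI])
      have eq: "(\<lambda>x. f x * cnj (indicator (I k) x)) = (\<lambda>x. indicator (I k) x *\<^sub>R f x)"
        by (auto simp: indicator_def)
      have "cinner (abs_L2R f) (g k) = integral\<^sup>L lebesgue (\<lambda>x. indicator (I k) x *\<^sub>R f x)"
        unfolding g_def cinner_abs_L2R[OF sf(1) sI] eq ..
      also have "\<dots> = integral (I k) f"
        using set_lebesgue_integral_eq_integral(2)[of "I k" f] int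
        unfolding eq set_integrable_def set_lebesgue_integral_def by blast
      finally show ?thesis .
    qed
    have "integral {-R..R} (\<lambda>x. (norm (f x))\<^sup>2)
        \<le> 2 / h * (\<Sum>k<N. (norm (integral (I k) f))\<^sup>2) + 2 * h\<^sup>2 * integral {-R..R} (\<lambda>x. (norm (vderiv f x))\<^sup>2)"
      using subdivided_poincare[OF f h(1), of "- R" N] by (simp only: h(3) I_def)
    moreover have "2 * h\<^sup>2 * integral {-R..R} (\<lambda>x. (norm (vderiv f x))\<^sup>2)
        \<le> \<epsilon> * (c / 2) * integral\<^sup>L lebesgue (\<lambda>x. (norm (vderiv f x))\<^sup>2)"
    proof (rule mult_mono[OF h2])
      have hi: "((\<lambda>x. (norm (vderiv f x))\<^sup>2) has_integral integral\<^sup>L lebesgue (\<lambda>x. (norm (vderiv f x))\<^sup>2)) UNIV"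
        by (rule has_integral_integral_lebesgue[OF i(2)])
      show "integral {-R..R} (\<lambda>x. (norm (vderiv f x))\<^sup>2) \<le> integral\<^sup>L lebesgue (\<lambda>x. (norm (vderiv f x))\<^sup>2)"
        unfolding integral_unique[OF hi, symmetric]
        using hi by (intro integral_subset_le integrable_continuous_real continuous_intros
            continuous_on_test_function f') auto
      show "0 \<le> integral {-R..R} (\<lambda>x. (norm (vderiv f x))\<^sup>2)"
        by (intro integral_nonneg integrable_continuous_real continuous_intros
            continuous_on_test_function f') auto
    qed (use assms m in auto)
    moreover have "integral {-R..R} (\<lambda>x. (norm (f x))\<^sup>2)
        = integral\<^sup>L lebesgue (\<lambda>x. indicator {-R..R} x * (norm (f x))\<^sup>2)"
      using set_lebesgue_integral_eq_integral(2)[of "{-R..R}" "\<lambda>x. (norm (f x))\<^sup>2"] io(2)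
      unfolding set_integrable_def set_lebesgue_integral_def real_scaleR_def by simp
    moreover have "(norm (abs_L2R f))\<^sup>2 = integral\<^sup>L lebesgue (\<lambda>x. indicator {-R..R} x * (norm (f x))\<^sup>2)
       + integral\<^sup>L lebesgue (\<lambda>x. indicator (- {-R..R}) x * (norm (f x))\<^sup>2)"
      unfolding norm_L2R_abs[OF sf(1)] Bochner_Integration.integral_add[OF io(2,1), symmetric]
      by (rule Bochner_Integration.integral_cong) (auto simp: indicator_def)
    \<comment> \<open>The energy estimate at level \<open>1 / \<epsilon>\<close>, multiplied by
      \<open>\<epsilon>\<close>, gives the outer mass coefficient 1.\<close>
    moreover have "\<epsilon> * (c / 2) * integral\<^sup>L lebesgue (\<lambda>x. (norm (vderiv f x))\<^sup>2)
        + integral\<^sup>L lebesgue (\<lambda>x. indicator (- {-R..R}) x * (norm (f x))\<^sup>2)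
      \<le> \<epsilon> * (Re (cinner (mult_L2R m (abs_L2R (\<lambda>x. - vderiv (vderiv f) x + V x * f x))) (abs_L2R f))
        + C * (norm (abs_L2R f))\<^sup>2)"
      using mult_left_mono[OF energy_estimate[OF f ae], of \<epsilon>] assms by (simp add: C_def algebra_simps)
    ultimately show ?thesis
      unfolding P_def prod.case inI by linarith
  qed
  then have "minimal_schroedinger V \<subseteq> {w. P w}"
    by (auto simp: minimal_schroedinger_def)
  \<comment> \<open>Both sides of \<open>P\<close> depend continuously on the pair, since
    multiplication by \<open>m\<close> is bounded. This carries the estimate from test functions to
    the closed operator.\<close>
  moreover have "closed {w. P w}"
    unfolding P_def case_prod_beta
    by (intro closed_Collect_le continuous_intros
        bounded_linear.continuous_on[OF bounded_linear_mult_L2R[OF measurable_m m(2)]])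
  ultimately have "closure (minimal_schroedinger V) \<subseteq> {w. P w}"
    by (rule closure_minimal)
  then show ?thesis
    unfolding C_def[symmetric] by (intro exI[of _ g] exI[of _ N] exI[of _ "2 / h"]) (auto simp: P_def)
qed

text \<open>If the form were bounded by \<open>K\<close>, a small \<open>\<epsilon>\<close> would
  leave at least half of the unit norm to the functionals in the compactness estimate, which tend to
  0 along a weakly null sequence.\<close>

lemma form_unbounded_on_weakly_null:
  assumes T: "\<And>n. (x n, y n) \<in> closure (minimal_schroedinger V)"
    and norm: "\<And>n. norm (x n) = 1" and weak: "weakly_null x"
  shows "\<not> bounded (range (\<lambda>n. cinner (mult_L2R m (y n)) (x n)))"
proof
  assume "bounded (range (\<lambda>n. cinner (mult_L2R m (y n)) (x n)))"
  then obtain K where K: "\<And>n. norm (cinner (mult_L2R m (y n)) (x n)) \<le> K"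
    by (auto simp: bounded_iff)
  define C where "C = r + L\<^sup>2 / (2 * c)"
  have C: "0 \<le> C"
    using r m(4) by (simp add: C_def)
  have K0: "0 \<le> K"
    using K[of 0] norm_ge_zero order.trans by blast
  \<comment> \<open>The \<open>+ 1\<close> keeps the denominator positive even if \<open>K\<close>
    and \<open>C\<close> are both 0.\<close>
  define \<epsilon> where "\<epsilon> = 1 / (2 * (K + C + 1))"
  have \<epsilon>: "0 < \<epsilon>" "\<epsilon> * (K + C) \<le> 1 / 2"
    using C K0 by (auto simp: \<epsilon>_def field_simps)
  obtain g :: "nat \<Rightarrow> L2R" and N and D where
    est: "\<And>u v. (u, v) \<in> closure (minimal_schroedinger V) \<Longrightarrow>
      (norm u)\<^sup>2 \<le> \<epsilon> * (Re (cinner (mult_L2R m v) u) + C * (norm u)\<^sup>2)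
        + D * (\<Sum>k<N. (norm (cinner u (g k)))\<^sup>2)"
    using compactness_estimate[OF \<epsilon>(1)] unfolding C_def[symmetric] by blast
  have "1 / 2 \<le> D * (\<Sum>k<N. (norm (cinner (x n) (g k)))\<^sup>2)" for n
  proof -
    have "\<epsilon> * (Re (cinner (mult_L2R m (y n)) (x n)) + C) \<le> \<epsilon> * (K + C)"
      using K[of n] \<epsilon>(1) complex_Re_le_cmod[of "cinner (mult_L2R m (y n)) (x n)"]
      by (intro mult_left_mono) auto
    then show ?thesis
      using est[OF T[of n]] \<epsilon>(2) by (simp add: norm)
  qed
  moreover have "(\<lambda>n. D * (\<Sum>k<N. (norm (cinner (x n) (g k)))\<^sup>2)) \<longlonglongrightarrow> D * (\<Sum>k<N. (norm (0::complex))\<^sup>2)"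
    using weak unfolding weakly_null_def by (intro tendsto_intros) auto
  ultimately have "1 / 2 \<le> D * (\<Sum>k<N. (norm (0::complex))\<^sup>2)"
    by (intro LIMSEQ_le_const) auto
  then show False
    by simp
qed

section \<open>Emptiness of the three ranges\<close>

lemma ess_num_ranges_empty:
  defines "T \<equiv> closure (minimal_schroedinger V)" and "B \<equiv> multiplication_op m"
  shows "ess_num_range (T O B) = {}" "pencil_ess_quotients (T O B) B = {}"
    "pencil_ess_num_range (T O B) B = {}"
proof -
  have B: "(u, v) \<in> B \<longleftrightarrow> v = mult_L2R m u" for u v
    unfolding B_def by (rule multiplication_op_iff[OF measurable_m m(2)])
  have unbounded: "\<not> bounded (range (\<lambda>n. cinner (y n) (x n)))"
    if "\<And>n. (x n, y n) \<in> T O B" "\<And>n. norm (x n) = 1" "weakly_null x" for x y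
  proof -
    \<comment> \<open>Recovers the intermediate vector of the product, the value of
      \<open>T\<close>, on which the form lemma is stated.\<close>
    have "\<exists>t. (x n, t) \<in> T \<and> y n = mult_L2R m t" for n
      using that(1)[of n] by (auto simp: B)
    then obtain t where t: "\<And>n. (x n, t n) \<in> T" "\<And>n. y n = mult_L2R m (t n)"
      by metis
    show ?thesis
      unfolding t(2) by (rule form_unbounded_on_weakly_null[OF t(1)[unfolded T_def] that(2,3)])
  qed
  have Bb: "norm (cinner z x) \<le> 2" if "(x, z) \<in> B" "norm x = 1" for x z
    using norm_cinner_le[of z x] norm_mult_L2R[OF measurable_m m(2), of x] that B by simp
  show "ess_num_range (T O B) = {}"
  proof (rule equals0I)
    fix \<mu> assume "\<mu> \<in> ess_num_range (T O B)"
    then obtain x y where xy: "\<And>n. (x n, y n) \<in> T O B" "\<And>n. norm (x n) = 1" "weakly_null x"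
      and lim: "(\<lambda>n. cinner (y n) (x n)) \<longlonglongrightarrow> \<mu>"
      by (auto simp: ess_num_range_def)
    show False
      using unbounded[OF xy] convergent_imp_bounded[OF lim] by contradiction
  qed
  show "pencil_ess_num_range (T O B) B = {}"
  proof (rule equals0I)
    fix \<zeta> assume "\<zeta> \<in> pencil_ess_num_range (T O B) B"
    then obtain x w where w: "\<And>n. (x n, w n) \<in> pencil (T O B) B \<zeta>" "\<And>n. norm (x n) = 1"
      "weakly_null x" and lim: "(\<lambda>n. cinner (w n) (x n)) \<longlonglongrightarrow> 0"
      by (auto simp: pencil_ess_num_range_def ess_num_range_def)
    have "\<forall>n. \<exists>y z. (x n, y) \<in> T O B \<and> (x n, z) \<in> B \<and> w n = y - \<zeta> *\<^sub>C z"
      using w(1) unfolding pencil_def by blast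
    then obtain y z where yz: "\<And>n. (x n, y n) \<in> T O B" "\<And>n. (x n, z n) \<in> B"
      "\<And>n. w n = y n - \<zeta> *\<^sub>C z n"
      by metis
    \<comment> \<open>Solving the pencil for the form of \<open>T O B\<close> leaves a convergent
      sequence plus a bounded one.\<close>
    have eq: "cinner (y n) (x n) = cinner (w n) (x n) + \<zeta> * cinner (z n) (x n)" for n
      using cinner_add_left[of "w n" "\<zeta> *\<^sub>C z n" "x n"] by (simp add: yz(3) cinner_scaleC_left)
    obtain K where K: "\<And>n. norm (cinner (w n) (x n)) \<le> K"
      using convergent_imp_bounded[OF lim] by (auto simp: bounded_iff)
    have "norm (cinner (y n) (x n)) \<le> K + norm \<zeta> * 2" for n
      unfolding eq using K Bb[OF yz(2) w(2)]
      by (intro norm_triangle_mono) (auto simp: norm_mult intro!: mult_left_mono)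
    then show False
      using unbounded[OF yz(1) w(2,3)] by (auto simp: bounded_iff)
  qed
  show "pencil_ess_quotients (T O B) B = {}"
  proof (rule equals0I)
    fix \<zeta> assume "\<zeta> \<in> pencil_ess_quotients (T O B) B"
    then obtain x y z where yz: "\<And>n. (x n, y n) \<in> T O B" "\<And>n. (x n, z n) \<in> B"
      "\<And>n. cinner (z n) (x n) \<noteq> 0" "\<And>n. norm (x n) = 1" "weakly_null x"
      and lim: "(\<lambda>n. cinner (y n) (x n) / cinner (z n) (x n)) \<longlonglongrightarrow> \<zeta>"
      unfolding pencil_ess_quotients_def by blast
    obtain K where K: "\<And>n. norm (cinner (y n) (x n) / cinner (z n) (x n)) \<le> K"
      using convergent_imp_bounded[OF lim] by (auto simp: bounded_iff)
    have K0: "0 \<le> K"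
      using K[of 0] norm_ge_zero order.trans by blast
    have "norm (cinner (y n) (x n)) \<le> K * 2" for n
    proof -
      \<comment> \<open>A convergent quotient times a bounded denominator is bounded, however small
        the denominators become.\<close>
      have "norm (cinner (y n) (x n))
          = norm (cinner (y n) (x n) / cinner (z n) (x n)) * norm (cinner (z n) (x n))"
        using yz(3)[of n] by (simp add: norm_divide)
      also have "\<dots> \<le> K * 2"
        using K Bb[OF yz(2,4)] K0 by (intro mult_mono) auto
      finally show ?thesis .
    qed
    then show False
      using unbounded[OF yz(1,4,5)] by (auto simp: bounded_iff)
  qed
qed

end

section \<open>Sectors and the rotating phase\<close>

lemma Re_sector_ge:
  assumes "z \<in> sector \<theta>" "0 \<le> \<theta>" "\<theta> < pi / 2"
  shows "cos \<theta> * norm z \<le> Re z"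
proof -
  have "cos \<theta> \<le> cos \<bar>Arg z\<bar>"
    using assms pi_gt_zero by (intro cos_monotone_0_pi_le) (auto simp: sector_def)
  then have "cos \<theta> * norm z \<le> cos (Arg z) * norm z"
    by (intro mult_right_mono) auto
  also have "\<dots> = Re z"
    using rcis_cmod_Arg[of z] by (metis Re_rcis mult.commute)
  finally show ?thesis .
qed

theorem theorem4p5:
  fixes V \<beta> :: "real \<Rightarrow> complex"
    and \<theta> a b \<phi>\<^sub>m \<phi>\<^sub>p r :: real
    and T B :: "(L2R \<times> L2R) set"
  assumes "locally_square_integrable V"
    and "filterlim (\<lambda>x. norm (V x)) at_top at_infinity"
    and "0 \<le> \<theta>" and "\<theta> < pi / 2"
    and "a < b"
    and "\<phi>\<^sub>m \<in> {-(pi / 2)<..<pi / 2}" and "\<phi>\<^sub>p \<in> {-(pi / 2)<..<pi / 2}"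
    and "0 < r"
    and "AE x in lebesgue.
           (x \<in> {..a} \<longrightarrow> V x \<in> (\<lambda>z. cis \<phi>\<^sub>m * z) ` sector \<theta>) \<and>
           (x \<in> {a<..<b} \<longrightarrow> V x \<in> ball 0 r) \<and>
           (x \<in> {b..} \<longrightarrow> V x \<in> (\<lambda>z. cis \<phi>\<^sub>p * z) ` sector \<theta>)"
    and "T = closure (minimal_schroedinger V)"
    and "\<beta> = (\<lambda>x. if x \<le> a then cis (- \<phi>\<^sub>m)
                  else if x < b then
                    (let t = (b - x) / (b - a) in cis (- (t * \<phi>\<^sub>m + (1 - t) * \<phi>\<^sub>p)))
                  else cis (- \<phi>\<^sub>p))"
    and "B = multiplication_op \<beta>"
  shows "ess_num_range (T O B) = {} \<and>
         pencil_ess_quotients (T O B) B = pencil_ess_num_range (T O B) B \<and>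
         pencil_ess_num_range (T O B) B = {}"
proof -
  \<comment> \<open>truncating \<open>(x - a) / (b - a)\<close> to \<open>[0, 1]\<close> gives one continuous phase with \<open>\<beta> = cis (- \<psi>)\<close>\<close>
  define \<psi> where "\<psi> = (\<lambda>x. \<phi>\<^sub>m + (\<phi>\<^sub>p - \<phi>\<^sub>m) * max 0 (min 1 ((x - a) / (b - a))))"
  \<comment> \<open>The derivative of \<open>\<psi>\<close> off the corners \<open>a\<close> and
    \<open>b\<close>, where the value 0 is a default. The next definition is the resulting
    derivative of \<open>cis (- \<psi> x)\<close>.\<close>
  define \<psi>' where "\<psi>' = (\<lambda>x. (\<phi>\<^sub>p - \<phi>\<^sub>m) / (b - a) * indicator {a<..<b} x)"
  define \<beta>' where "\<beta>' = (\<lambda>x. - \<i> * complex_of_real (\<psi>' x) * \<beta> x)"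
  have ab: "0 < b - a"
    using assms(5) by simp
  have \<psi>_left: "\<psi> x = \<phi>\<^sub>m" if "x \<le> a" for x
  proof -
    have "(x - a) / (b - a) \<le> 0"
      using that ab by (simp add: divide_le_0_iff)
    then show ?thesis
      by (simp add: \<psi>_def)
  qed
  have \<psi>_right: "\<psi> x = \<phi>\<^sub>p" if "b \<le> x" for x
    using that ab by (simp add: \<psi>_def min_def max_def field_simps)
  have \<psi>_mid: "\<psi> x = \<phi>\<^sub>m + (\<phi>\<^sub>p - \<phi>\<^sub>m) / (b - a) * (x - a)" if "a \<le> x" "x \<le> b" for x
  proof -
    have "0 \<le> (x - a) / (b - a)" "(x - a) / (b - a) \<le> 1"
      using that ab by simp_all
    then show ?thesis
      by (simp add: \<psi>_def)
  qed
  have \<beta>: "\<beta> x = cis (- \<psi> x)" for x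
  proof -
    consider "x \<le> a" | "a < x" "x < b" | "b \<le> x"
      by linarith
    then show ?thesis
    proof cases
      case 2
      \<comment> \<open>The parameter \<open>t\<close> of the statement falls from 1 at
        \<open>a\<close> to 0 at \<open>b\<close>, so the weight of \<open>\<phi>\<^sub>p\<close> is
        \<open>(x - a) / (b - a)\<close>.\<close>
      have "\<phi>\<^sub>m + (\<phi>\<^sub>p - \<phi>\<^sub>m) / (b - a) * (x - a)
          = (b - x) / (b - a) * \<phi>\<^sub>m + (1 - (b - x) / (b - a)) * \<phi>\<^sub>p"
        using ab by (simp add: divide_simps) (simp add: algebra_simps)
      then show ?thesis
        using 2 \<psi>_mid[of x] by (simp add: assms(11) Let_def)
    qed (use assms(5) \<psi>_left \<psi>_right in \<open>auto simp: assms(11)\<close>)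
  qed
  have cont_\<psi>: "continuous_on UNIV \<psi>"
    unfolding \<psi>_def using ab by (intro continuous_intros) auto
  have cont: "continuous_on UNIV \<beta>"
    unfolding \<beta> cis_conv_exp using cont_\<psi> by (intro continuous_intros)
  have norm_\<beta>: "norm (\<beta> x) \<le> 1" for x
    by (simp add: \<beta>)
  \<comment> \<open>Interpolated phases stay between the two end phases, so \<open>cos M\<close> can
    serve as the constant \<open>c\<close> of the estimates.\<close>
  define M where "M = max \<bar>\<phi>\<^sub>m\<bar> \<bar>\<phi>\<^sub>p\<bar>"
  have M: "0 \<le> M" "M < pi / 2"
    using assms(6,7) by (auto simp: M_def)
  have "\<bar>\<psi> x\<bar> \<le> M" for x
  proof -
    define t where "t = max 0 (min 1 ((x - a) / (b - a)))"
    have t: "0 \<le> t" "t \<le> 1"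
      by (auto simp: t_def)
    have "\<psi> x = (1 - t) * \<phi>\<^sub>m + t * \<phi>\<^sub>p"
      by (simp add: \<psi>_def t_def algebra_simps)
    also have "\<bar>\<dots>\<bar> \<le> (1 - t) * \<bar>\<phi>\<^sub>m\<bar> + t * \<bar>\<phi>\<^sub>p\<bar>"
      using t abs_triangle_ineq[of "(1 - t) * \<phi>\<^sub>m" "t * \<phi>\<^sub>p"] by (simp add: abs_mult)
    also have "\<dots> \<le> (1 - t) * M + t * M"
      using t by (intro add_mono mult_left_mono) (auto simp: M_def)
    finally show ?thesis
      by (simp add: algebra_simps)
  qed
  then have Re_\<beta>: "cos M \<le> Re (\<beta> x)" for x
    using cos_monotone_0_pi_le[of "\<bar>\<psi> x\<bar>" M] M by (simp add: \<beta>)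
  have cosM: "0 < cos M"
    using M by (intro cos_gt_zero_pi) auto
  have meas: "\<beta>' \<in> borel_measurable lebesgue"
  proof -
    have "\<beta> \<in> borel_measurable lebesgue"
      using cont by (simp add: borel_measurable_continuous_onI measurable_completion)
    moreover have "\<psi>' \<in> borel_measurable borel"
      unfolding \<psi>'_def by measurable
    then have "\<psi>' \<in> borel_measurable lebesgue"
      by (simp add: measurable_completion)
    ultimately show ?thesis
      unfolding \<beta>'_def by measurable
  qed
  have bound: "norm (\<beta>' x) \<le> \<bar>(\<phi>\<^sub>p - \<phi>\<^sub>m) / (b - a)\<bar>" for x
  proof -
    have "norm (\<beta>' x) = \<bar>\<psi>' x\<bar>"
      unfolding \<beta>'_def \<beta> norm_mult by simp
    then show ?thesis
      by (simp add: \<psi>'_def indicator_def)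
  qed
  have der: "\<forall>x. x \<notin> {a, b} \<longrightarrow> (\<beta> has_vector_derivative \<beta>' x) (at x)"
  proof (intro allI impI)
    fix x assume "x \<notin> {a, b}"
    then have "x \<noteq> a" "x \<noteq> b"
      by auto
    then consider "x < a" | "a < x" "x < b" | "b < x"
      by linarith
    then have "(\<psi> has_real_derivative \<psi>' x) (at x)"
    proof cases
      case 1
      show ?thesis
        by (rule has_field_derivative_transform_within_open[where S = "{..<a}" and f = "\<lambda>x. \<phi>\<^sub>m"])
           (use 1 \<psi>_left in \<open>auto simp: \<psi>'_def\<close>)
    next
      case 2
      show ?thesis
        by (rule has_field_derivative_transform_within_open[where S = "{a<..<b}" and
              f = "\<lambda>x. \<phi>\<^sub>m + (\<phi>\<^sub>p - \<phi>\<^sub>m) / (b - a) * (x - a)"])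
           (use 2 \<psi>_mid in \<open>auto simp: \<psi>'_def intro!: derivative_eq_intros\<close>)
    next
      case 3
      show ?thesis
        by (rule has_field_derivative_transform_within_open[where S = "{b<..}" and f = "\<lambda>x. \<phi>\<^sub>p"])
           (use 3 \<psi>_right in \<open>auto simp: \<psi>'_def\<close>)
    qed
    then have "((\<lambda>x. - \<psi> x) has_real_derivative - \<psi>' x) (at x)"
      by (rule DERIV_minus)
    then have "((\<lambda>x. \<i> * complex_of_real (- \<psi> x)) has_vector_derivative \<i> * complex_of_real (- \<psi>' x)) (at x)"
      by (intro has_vector_derivative_mult_right has_vector_derivative_of_real)
         (simp add: has_real_derivative_iff_has_vector_derivative)
    then have "((exp \<circ> (\<lambda>x. \<i> * complex_of_real (- \<psi> x))) has_vector_derivative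
        (\<i> * complex_of_real (- \<psi>' x)) * exp (\<i> * complex_of_real (- \<psi> x))) (at x)"
      by (rule field_vector_diff_chain_at) (rule DERIV_exp)
    moreover have "\<beta> = exp \<circ> (\<lambda>x. \<i> * complex_of_real (- \<psi> x))"
      by (rule ext) (simp add: \<beta> cis_conv_exp)
    ultimately show "(\<beta> has_vector_derivative \<beta>' x) (at x)"
      by (simp add: \<beta>'_def)
  qed
  have cos\<theta>: "0 < cos \<theta>"
    using assms(3,4) by (intro cos_gt_zero_pi) auto
  have coercive: "\<exists>R. AE x in lebesgue. (if \<bar>x\<bar> \<le> R then - r else \<kappa>) \<le> Re (\<beta> x * V x)" for \<kappa>
  proof -
    \<comment> \<open>Passing from modulus to real part in the sector costs the factor
      \<open>cos \<theta>\<close>, which the threshold compensates.\<close>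
    obtain R0 where R0: "\<And>x. R0 \<le> \<bar>x\<bar> \<Longrightarrow> \<bar>\<kappa>\<bar> / cos \<theta> \<le> norm (V x)"
      using assms(2) unfolding filterlim_at_top eventually_at_infinity by fastforce
    \<comment> \<open>With \<open>a\<close> and \<open>b\<close> included, the middle interval,
      where only the bound \<open>- r\<close> is available, lies within radius
      \<open>R\<close>.\<close>
    define R where "R = max R0 (max \<bar>a\<bar> \<bar>b\<bar>)"
    have outer: "(if \<bar>x\<bar> \<le> R then - r else \<kappa>) \<le> Re (\<beta> x * V x)"
      if V: "V x \<in> (\<lambda>z. cis \<phi> * z) ` sector \<theta>" and "\<psi> x = \<phi>" for x \<phi>
    proof -
      obtain z where z: "z \<in> sector \<theta>" "V x = cis \<phi> * z"
        using V by blast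
      \<comment> \<open>The multiplier has the opposite phase and undoes the rotation of the
        sector.\<close>
      have "\<beta> x * V x = z"
        by (simp add: \<beta> z that(2) cis_mult flip: mult.assoc)
      moreover have "norm (V x) = norm z"
        by (simp add: z norm_mult)
      ultimately have *: "cos \<theta> * norm (V x) \<le> Re (\<beta> x * V x)"
        using Re_sector_ge[OF z(1) assms(3,4)] by simp
      moreover have "0 \<le> cos \<theta> * norm (V x)"
        using cos\<theta> by simp
      moreover have "\<bar>\<kappa>\<bar> \<le> cos \<theta> * norm (V x)" if "R < \<bar>x\<bar>"
        using R0[of x] that cos\<theta> by (simp add: R_def field_simps)
      ultimately show ?thesis
        using assms(8) by (auto simp del: times_complex.sel)
    qed
    have inner: "(if \<bar>x\<bar> \<le> R then - r else \<kappa>) \<le> Re (\<beta> x * V x)"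
      if "a < x" "x < b" "V x \<in> ball 0 r" for x
    proof -
      have "\<bar>Re (\<beta> x * V x)\<bar> \<le> norm (\<beta> x * V x)"
        by (rule abs_Re_le_cmod)
      also have "\<dots> < r"
        using that(3) by (simp add: \<beta> norm_mult)
      finally show ?thesis
        using that(1,2) by (auto simp: R_def simp del: times_complex.sel)
    qed
    have "AE x in lebesgue. (if \<bar>x\<bar> \<le> R then - r else \<kappa>) \<le> Re (\<beta> x * V x)"
      using assms(9)
    proof eventually_elim
      case (elim x)
      consider "x \<le> a" | "a < x" "x < b" | "b \<le> x"
        by linarith
      then show ?case
        using elim outer[of x \<phi>\<^sub>m] outer[of x \<phi>\<^sub>p] inner[of x] \<psi>_left[of x] \<psi>_right[of x]
        by cases (simp_all del: times_complex.sel)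
    qed
    then show ?thesis
      by blast
  qed
  have "finite {a, b}" "0 \<le> r"
    using assms(8) by auto
  note empty = ess_num_ranges_empty[OF assms(1) cont norm_\<beta> Re_\<beta> cosM \<open>finite {a, b}\<close> meas bound der
      coercive \<open>0 \<le> r\<close>]
  show ?thesis
    unfolding assms(10,12) by (simp add: empty)
qed

end
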